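(* Let $(\mathcal{F}_m)_{m\in\mathcal{M}_n}$ be a family of models and $(\varphi_m)_{m\in\mathcal{M}_n}$ a family of convex non-decreasing functions on $[0,\infty)$ with $\varphi_m(0)=0$ such that the local margin conditions hold: for every $m\in\mathcal{M}_n$, $$\forall f\in\mathcal{F}_m,\qquad P(f-f^{\star})\ \ge\ \varphi_m\Bigl(\sqrt{\operatorname{var}_P(f-f^{\star})}\Bigr).$$ Let $(t_m)_{m\in\mathcal{M}_n}$ be positive reals that are non-decreasing with respect to the inclusion ordering on the models (i.e. $\mathcal{F}_{m'}\subset\mathcal{F}_m$ implies $t_{m'}\le t_m$). For every $m\in\mathcal{M}_n$ let $$v(m):=\sqrt{\frac{2t_m}{n}\operatorname{var}_P(f_m-f^{\star})}.$$ Assume that constants $c,\eta\in(0,1)$ and $C_1,C_2\ge 0$ exist such that: (1) the models $(\mathcal{F}_m)_{m\in\mathcal{M}_n}$ are nested (for all $m,m'$, either $\mathcal{F}_m\subset\mathcal{F}_{m'}$ or $\mathcal{F}_{m'}\subset\mathcal{F}_m$); (2) with probability at least $1-\eta$, for every $m,m'\in\mathcal{M}_n$, $$(1-c)\operatorname{pen}(m)\ \ge\ (P-P_n)(\widehat f_m-f_m)+\frac{t_m}{n}\ \ge\ 0,$$ $$\mathcal{F}_{m'}\subset\mathcal{F}_m\ \Longrightarrow\ c\operatorname{pen}(m)\ \ge\ v(m)-C_1v(m')-C_2P(f_{m'}-f^{\star}).$$ Then, if $\widehat m\in\arg\min_{m\in\mathcal{M}_n}\{P_n(\widehat f_m)+\operatorname{pen}(m)\}$,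 with probability at least $1-\eta-2\sum_{m\in\mathcal{M}_n}e^{-t_m}$ we have, for every $\varepsilon\in(0,1)$, $$P(\widehat f_{\widehat m}-f^{\star})\le\frac{1}{1-\varepsilon}\inf_{m\in\mathcal{M}_n}\Biggl\{(1+\varepsilon+C_2+\varepsilon C_1)P(f_m-f^{\star})+\operatorname{pen}(m)+(1+\max\{1,C_1\})\min\Biggl\{\varphi_m^{\star}\Biggl(\sqrt{\frac{2t_m}{\varepsilon^2n}}\Biggr),\sqrt{\frac{2t_m}{n}}\Biggr\}+\frac{t_m}{3n}\Biggr\},$$ where $\varphi_m^{\star}(x):=\sup_{y\ge 0}\{xy-\varphi_m(y)\}$ is the convex conjugate of $\varphi_m$.
   Context: General empirical minimization framework. $\xi_1,\dots,\xi_n$ are i.i.d. random variables with distribution $P$ on a measurable space $\Xi$; $P_n=n^{-1}\sum_{i=1}^n\delta_{\xi_i}$ is the empirical measure. $\mathcal{F}$ is a set of measurable functions $\Xi\to[0,1]$. For a function $f$, $P(f):=\mathbb{E}_{\xi\sim P}[f(\xi)]$, $P_n(f):=n^{-1}\sum_i f(\xi_i)$, and $\operatorname{var}_P(f)$ is the variance of $f(\xi)$, $\xi\sim P$. When $f$ is a data-dependent function (such as $\widehat f_m$), $P(f)$ is the integral of $f$ with respect to $P$ with the data held fixed (hence a random quantity). It is assumed that a minimizer $f^{\star}$ of $P(f)$ over $\mathcal{F}$ exists. Each model $\mathcal{F}_m\subset\mathcal{F}$, $m\in\mathcal{M}_n$, where $\mathcal{M}_n$ is an (at most countable) index set. For every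 $m$, $f_m\in\arg\min_{f\in\mathcal{F}_m}P(f)$ and $\widehat f_m\in\arg\min_{f\in\mathcal{F}_m}P_n(f)$ (empirical minimizer); these minimizers, and $\widehat m$, are assumed to exist (and measurability is tacitly assumed). $\operatorname{pen}:\mathcal{M}_n\to\mathbb{R}$ is a data-dependent function, called the penalty. *)

theory Defs
  imports "HOL-Probability.Probability"
begin

definition emp_mean :: "nat \<Rightarrow> (nat \<Rightarrow> 'w \<Rightarrow> 'x) \<Rightarrow> 'w \<Rightarrow> ('x \<Rightarrow> real) \<Rightarrow> real" where
  "emp_mean n \<xi> \<omega> f = (\<Sum>i=1..n. f (\<xi> i \<omega>)) / real n"

text \<open>Excess risk \<open>P(f - fstar)\<close>. For a data-dependent \<open>f\<close> the data are held fixed: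
  \<open>f\<close> is already evaluated at the outcome.\<close>

definition excess_risk :: "'x measure \<Rightarrow> ('x \<Rightarrow> real) \<Rightarrow> ('x \<Rightarrow> real) \<Rightarrow> real" where
  "excess_risk P fstar f = (\<integral>x. (f x - fstar x) \<partial>P)"

definition excess_var :: "'x measure \<Rightarrow> ('x \<Rightarrow> real) \<Rightarrow> ('x \<Rightarrow> real) \<Rightarrow> real" where
  "excess_var P fstar f = prob_space.variance P (\<lambda>x. f x - fstar x)"

text \<open>The supremum may be infinite, hence the extended reals.\<close>

definition convex_conjugate :: "(real \<Rightarrow> real) \<Rightarrow> real \<Rightarrow> ereal" where
  "convex_conjugate \<phi> x = (SUP y\<in>{0..}. ereal (x * y - \<phi> y))"

text \<open>\<open>Q\<close> holds with probability at least \<open>p\<close>. The set where \<open>Q\<close> holds need not be measurable;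
  when it is, this says exactly that its probability is at least \<open>p\<close>. The bound \<open>p\<close> is extended
  real because it may involve a divergent sum.\<close>

definition holds_with_prob_ge :: "'w measure \<Rightarrow> ereal \<Rightarrow> ('w \<Rightarrow> bool) \<Rightarrow> bool" where
  "holds_with_prob_ge M p Q \<longleftrightarrow> (\<exists>E\<in>sets M. p \<le> ereal (measure M E) \<and> (\<forall>\<omega>\<in>E. Q \<omega>))"

end

theory Submission imports Defs begin

text \<open>
  Write \<open>k\<close> for the selected index and \<open>R\<close> for the excess risk. Minimality of \<open>k\<close> and of the
  empirical minimizers gives, for every \<open>m\<close>,
  \<open>R (fhat k) \<le> R (f m) + pen m - pen k + (P - P\<^sub>n) (fhat k - f k) + (P - P\<^sub>n) (f k - f m)\<close>.
  The first condition on the penalty turns the first empirical process term into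
  \<open>(1 - c) pen k - t k / n\<close>. The second one is split at \<open>fstar\<close> and controlled by Bernstein's
  inequality for each of the two tails of each \<open>f m - fstar\<close>. What remains is to compare \<open>v k\<close>
  with \<open>c pen k\<close>. If the model \<open>k\<close> contains the model \<open>m\<close>, this is the second condition on the
  penalty; otherwise \<open>f k\<close> lies in the model \<open>m\<close>, so the margin condition of \<open>m\<close> applies to it,
  and Young's inequality for the conjugate of \<open>\<phi> m\<close> bounds \<open>v k\<close> by \<open>\<epsilon> R (f k) \<le> \<epsilon> R (fhat k)\<close>
  plus the minimum in the statement.
\<close>

section \<open>Bernstein's inequality under a one-sided bound\<close>

text \<open>For x <= 0 the denominator 2 already suffices. For x > 0 the right side grows with b, so
  b = x is the critical case. The factor 1 / (1 - b / 3) is the geometric series dominating the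
  Taylor remainder, as k! >= 2 * 3 ^ (k - 2) for k >= 2.\<close>

lemma exp_le_Bernstein:
  fixes x b :: real
  assumes "x \<le> b" "0 \<le> b" "b < 3"
  shows "exp x \<le> 1 + x + x\<^sup>2 / (2 * (1 - b / 3))"
proof (cases "x \<le> 0")
  case True
  \<comment> \<open>The quadratic Taylor bound holds at nonnegative arguments, hence is used at -x.
    Multiplied by the Taylor polynomial at x it yields 1 + x ^ 4 / 4 >= 1, which turns it into an
    upper bound of exp x.\<close>
  have "1 + (-x) + (-x)\<^sup>2 / 2 \<le> exp (-x)"
    using True by (intro exp_lower_Taylor_quadratic) simp
  moreover have "(1 - x + x\<^sup>2 / 2) * (1 + x + x\<^sup>2 / 2) = 1 + x ^ 4 / 4"
    by (simp add: algebra_simps power2_eq_square power4_eq_xxxx)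
  moreover have "0 < 1 + x + x\<^sup>2 / 2"
  proof -
    have "1 + x + x\<^sup>2 / 2 = ((1 + x)\<^sup>2 + 1) / 2"
      by (simp add: power2_eq_square algebra_simps)
    also have "\<dots> > 0"
      by (simp add: add_nonneg_pos)
    finally show ?thesis .
  qed
  ultimately have "1 + x ^ 4 / 4 \<le> exp (-x) * (1 + x + x\<^sup>2 / 2)"
    using mult_right_mono[of "1 - x + x\<^sup>2 / 2" "exp (-x)" "1 + x + x\<^sup>2 / 2"] by simp
  moreover have "0 \<le> x ^ 4 / 4"
    by simp
  ultimately have "1 \<le> exp (-x) * (1 + x + x\<^sup>2 / 2)"
    by linarith
  then have "exp x \<le> 1 + x + x\<^sup>2 / 2"
    by (simp add: exp_minus field_simps)
  also have "x\<^sup>2 / 2 \<le> x\<^sup>2 / (2 * (1 - b / 3))"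
    using assms by (intro divide_left_mono) auto
  finally show ?thesis by simp
next
  case False
  txt \<open>Up to the factor \<open>exp (-y)\<close>, the claim for \<open>b = x\<close> says that this Pade-type remainder is
    nonnegative at \<open>x\<close>.\<close>
  define g where "g y = (1 + 2 * y / 3 + y\<^sup>2 / 6) * exp (-y) + y / 3 - 1" for y :: real
  have "g 0 \<le> g x"
  proof (rule DERIV_nonneg_imp_nondecreasing[where f = g])
    show "0 \<le> x" using False by simp
    fix y :: real assume y: "0 \<le> y" "y \<le> x"
    have "(g has_real_derivative (1 - (1 + y + y\<^sup>2 / 2) * exp (-y)) / 3) (at y)"
      unfolding g_def
      by (auto intro!: derivative_eq_intros simp: field_simps power2_eq_square)
    moreover have "(1 + y + y\<^sup>2 / 2) * exp (-y) \<le> 1"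
      using exp_lower_Taylor_quadratic[OF y(1)] by (simp add: exp_minus field_simps)
    ultimately show "\<exists>d. (g has_real_derivative d) (at y) \<and> 0 \<le> d"
      by (intro exI[of _ "(1 - (1 + y + y\<^sup>2 / 2) * exp (-y)) / 3"]) auto
  qed
  then have "(1 - x / 3) * exp x \<le> 1 + 2 * x / 3 + x\<^sup>2 / 6"
    by (simp add: g_def exp_minus field_simps)
  also have "\<dots> = (1 - x / 3) * (1 + x + x\<^sup>2 / (2 * (1 - x / 3)))"
    using assms by (simp add: field_simps power2_eq_square)
  finally have "exp x \<le> 1 + x + x\<^sup>2 / (2 * (1 - x / 3))"
    using assms by (subst (asm) mult_le_cancel_left_pos) auto
  also have "x\<^sup>2 / (2 * (1 - x / 3)) \<le> x\<^sup>2 / (2 * (1 - b / 3))"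
    using assms by (intro divide_left_mono) auto
  finally show ?thesis by simp
qed

text \<open>Integrating the pointwise bound for the centred variable removes the linear term and
  leaves the variance; 1 + u <= exp u then gives a form that multiplies well over independent
  variables.\<close>

lemma (in prob_space) nn_integral_exp_le_Bernstein:
  fixes X :: "'a \<Rightarrow> real"
  assumes [measurable]: "random_variable borel X"
    and sq: "integrable M (\<lambda>x. (X x)\<^sup>2)"
    and le: "AE x in M. X x - expectation X \<le> b"
    and l: "0 \<le> l" "0 \<le> b" "l * b < 3"
  shows "(\<integral>\<^sup>+x. ennreal (exp (l * (X x - expectation X))) \<partial>M)
         \<le> ennreal (exp (l\<^sup>2 * variance X / (2 * (1 - l * b / 3))))"
proof -
  define Y where "Y x = X x - expectation X" for x
  have [measurable]: "random_variable borel Y"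
    unfolding Y_def by measurable
  have X: "integrable M X"
    using square_integrable_imp_integrable[OF _ sq] by simp
  have Y: "integrable M Y" "expectation Y = 0"
    unfolding Y_def using X by (auto simp: prob_space)
  have Y2: "integrable M (\<lambda>x. (Y x)\<^sup>2)"
    using X sq by (simp add: Y_def power2_diff)
  define D where "D = 2 * (1 - l * b / 3)"
  have exp_le: "AE x in M. exp (l * Y x) \<le> 1 + l * Y x + l\<^sup>2 * (Y x)\<^sup>2 / D"
    using le
  proof eventually_elim
    case (elim x)
    then show ?case
      using exp_le_Bernstein[of "l * Y x" "l * b"] l
      by (simp add: Y_def D_def mult_left_mono power_mult_distrib)
  qed
  then have "(\<integral>\<^sup>+x. ennreal (exp (l * Y x)) \<partial>M)
        \<le> (\<integral>\<^sup>+x. ennreal (1 + l * Y x + l\<^sup>2 * (Y x)\<^sup>2 / D) \<partial>M)"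
    by (intro nn_integral_mono_AE) (auto intro: ennreal_leI)
  also have "\<dots> = ennreal (expectation (\<lambda>x. 1 + l * Y x + l\<^sup>2 * (Y x)\<^sup>2 / D))"
  proof (rule nn_integral_eq_integral)
    show "integrable M (\<lambda>x. 1 + l * Y x + l\<^sup>2 * (Y x)\<^sup>2 / D)"
      using Y Y2 by simp
    show "AE x in M. 0 \<le> 1 + l * Y x + l\<^sup>2 * (Y x)\<^sup>2 / D"
      using exp_le by eventually_elim (rule order_trans[OF exp_ge_zero])
  qed
  also have "expectation (\<lambda>x. 1 + l * Y x + l\<^sup>2 * (Y x)\<^sup>2 / D) = 1 + l\<^sup>2 * variance X / D"
    using Y Y2 by (simp add: prob_space) (simp add: Y_def)
  also have "ennreal \<dots> \<le> ennreal (exp (l\<^sup>2 * variance X / D))"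
    by (intro ennreal_leI exp_ge_add_one_self)
  finally show ?thesis
    by (simp add: Y_def D_def)
qed

text \<open>For \<open>V > 0\<close> the optimal \<open>l\<close> is \<open>r / (1 + r b / 3)\<close> with \<open>r = sqrt (2 t / V)\<close>. It tends to
  \<open>3 / b\<close> as \<open>V\<close> vanishes, so \<open>V = 0\<close> needs a limit.\<close>
lemma Bernstein_exponent:
  fixes V b t p :: real
  assumes "0 \<le> V" "0 < b" "0 < t"
    and bound: "\<And>l. 0 < l \<Longrightarrow> l * b < 3 \<Longrightarrow>
      p \<le> exp (- l * (sqrt (2 * V * t) + b * t / 3) + l\<^sup>2 * V / (2 * (1 - l * b / 3)))"
  shows "p \<le> exp (-t)"
proof (cases "V = 0")
  case True
  have "p \<le> exp (- (l * (b * t / 3)))" if "0 < l" "l < 3 / b" for l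
    using bound[of l] that assms True by (simp add: field_simps)
  then have "\<forall>\<^sub>F l in at_left (3 / b). p \<le> exp (- (l * (b * t / 3)))"
    using assms by (auto simp: eventually_at_left[of 0 "3 / b"] intro!: exI[of _ 0])
  moreover have "((\<lambda>l. exp (- (l * (b * t / 3)))) \<longlongrightarrow> exp (- (3 / b * (b * t / 3)))) (at_left (3 / b))"
    by (intro tendsto_intros)
  ultimately have "p \<le> exp (- (3 / b * (b * t / 3)))"
    by (intro tendsto_lowerbound[where F = "at_left (3 / b)"]) auto
  then show ?thesis
    using assms by simp
next
  case False
  define r where "r = sqrt (2 * t / V)"
  define q where "q = 1 + r * b / 3"
  define l where "l = r / q"
  have V: "0 < V" using False assms by simp
  have r: "0 < r" using assms V by (simp add: r_def)
  have q: "1 < q" using r assms by (simp add: q_def)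
  have r2: "r\<^sup>2 * V = 2 * t" using assms V by (simp add: r_def)
  \<comment> \<open>At this \<open>r\<close> the linear gain \<open>r * sqrt (2 * V * t)\<close> is
    2 t and the quadratic cost \<open>r\<^sup>2 * V / 2\<close> is t, a net gain of t. The division
    by \<open>q\<close> is exactly balanced by the term in \<open>b\<close>.\<close>
  have rs: "r * sqrt (2 * V * t) = 2 * t"
  proof -
    have "r * sqrt (2 * V * t) = sqrt ((2 * t)\<^sup>2)"
      using V unfolding r_def real_sqrt_mult[symmetric] by (simp add: power2_eq_square)
    also have "\<dots> = 2 * t"
      using \<open>0 < t\<close> by (intro real_sqrt_unique) auto
    finally show ?thesis .
  qed
  have lb: "1 - l * b / 3 = 1 / q"
    using q by (simp add: l_def q_def field_simps)
  have "1 / q > 0" using q by simp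
  then have lb3: "l * b < 3" using lb by linarith
  have "- l * (sqrt (2 * V * t) + b * t / 3) + l\<^sup>2 * V / (2 * (1 - l * b / 3))
        = - (r * sqrt (2 * V * t) + r * b * t / 3) / q + r\<^sup>2 * V / (2 * q)"
    unfolding lb using q by (simp add: l_def field_simps power2_eq_square)
  also have "\<dots> = - (t * q) / q"
  proof -
    have "- (2 * t + r * b * t / 3) + t = - (t * q)"
      by (simp add: q_def algebra_simps)
    then have "- (t * q) / q = - (2 * t + r * b * t / 3) / q + t / q"
      by (simp only: add_divide_distrib[symmetric])
    then show ?thesis
      unfolding r2 rs by simp
  qed
  also have "\<dots> = - t" using q by simp
  finally show ?thesis
    using bound[of l] lb3 r q by (simp add: l_def)
qed

text \<open>Chernoff's method: exponential Markov with parameter \<open>l\<close>, factorization by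
  independence, the previous bound for each factor, and optimization over \<open>l\<close> by
  \<open>Bernstein_exponent\<close>.\<close>

lemma (in prob_space) Bernstein_ineq_ge:
  fixes X :: "'i \<Rightarrow> 'a \<Rightarrow> real"
  assumes fin: "finite I" and indep: "indep_vars (\<lambda>_. borel) X I"
    and sq: "\<And>i. i \<in> I \<Longrightarrow> integrable M (\<lambda>x. (X i x)\<^sup>2)"
    and le: "\<And>i. i \<in> I \<Longrightarrow> AE x in M. X i x - expectation (X i) \<le> b"
    and "0 < b" "0 < t"
  defines "V \<equiv> \<Sum>i\<in>I. variance (X i)"
  shows "prob {x\<in>space M. sqrt (2 * V * t) + b * t / 3 \<le> (\<Sum>i\<in>I. X i x) - (\<Sum>i\<in>I. expectation (X i))}
         \<le> exp (-t)"
proof (rule Bernstein_exponent)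
  show "0 \<le> V" unfolding V_def by (intro sum_nonneg) auto
  fix l :: real assume l: "0 < l" "l * b < 3"
  define s where "s = sqrt (2 * V * t) + b * t / 3"
  define E where "E i = expectation (X i)" for i
  define S where "S x = (\<Sum>i\<in>I. X i x) - (\<Sum>i\<in>I. expectation (X i))" for x
  define D where "D = 2 * (1 - l * b / 3)"
  have [measurable]: "random_variable borel (X i)" if "i \<in> I" for i
    using indep that unfolding indep_vars_def by auto
  have [measurable]: "random_variable borel S"
    unfolding S_def by measurable
  have "emeasure M {x\<in>space M. s \<le> S x}
        \<le> ennreal (exp (- l * s)) * (\<integral>\<^sup>+x\<in>space M. exp (l * S x) \<partial>M)"
    using l by (intro Chernoff_ineq_nn_integral_ge) auto
  also have "(\<integral>\<^sup>+x\<in>space M. exp (l * S x) \<partial>M) = (\<integral>\<^sup>+x. (\<Prod>i\<in>I. ennreal (exp (l * (X i x - E i)))) \<partial>M)"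
    by (intro nn_integral_cong)
       (simp_all add: S_def E_def sum_subtractf[symmetric] sum_distrib_left exp_sum fin prod_ennreal)
  also have "\<dots> = (\<Prod>i\<in>I. \<integral>\<^sup>+x. ennreal (exp (l * (X i x - E i))) \<partial>M)"
    by (intro indep_vars_nn_integral fin indep_vars_compose2[OF indep]) auto
  also have "\<dots> \<le> (\<Prod>i\<in>I. ennreal (exp (l\<^sup>2 * variance (X i) / D)))"
    unfolding E_def D_def using assms l
    by (intro prod_mono_ennreal nn_integral_exp_le_Bernstein) auto
  also have "\<dots> = ennreal (exp (l\<^sup>2 * V / D))"
    by (simp add: prod_ennreal exp_sum[symmetric] fin V_def sum_distrib_left sum_divide_distrib)
  finally have "emeasure M {x\<in>space M. s \<le> S x} \<le> ennreal (exp (- l * s)) * ennreal (exp (l\<^sup>2 * V / D))"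
    by (simp add: mult_left_mono)
  also have "\<dots> = ennreal (exp (- l * s + l\<^sup>2 * V / D))"
    by (simp only: exp_add ennreal_mult'' exp_ge_zero)
  finally show "prob {x\<in>space M. sqrt (2 * V * t) + b * t / 3 \<le> (\<Sum>i\<in>I. X i x) - (\<Sum>i\<in>I. expectation (X i))}
      \<le> exp (- l * (sqrt (2 * V * t) + b * t / 3) + l\<^sup>2 * V / (2 * (1 - l * b / 3)))"
    by (simp add: emeasure_eq_measure s_def S_def D_def)
qed (use assms in auto)

section \<open>Empirical means of an i.i.d. sample\<close>

lemma emp_mean_measurable:
  assumes "\<And>i. i \<in> {1..n} \<Longrightarrow> \<xi> i \<in> measurable M P" "g \<in> borel_measurable P"
  shows "(\<lambda>\<omega>. emp_mean n \<xi> \<omega> g) \<in> borel_measurable M"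
  unfolding emp_mean_def
  by (intro borel_measurable_divide borel_measurable_sum borel_measurable_const
        measurable_compose[OF assms(1) assms(2)])

text \<open>All means and variances transfer to \<open>P\<close>, and dividing the sum by n rescales
  the deviation. The two-sided bound \<open>B\<close> gives square integrability; only the one-sided
  bound \<open>b\<close> enters the deviation.\<close>

lemma emp_mean_Bernstein:
  fixes g :: "'x \<Rightarrow> real"
  assumes "prob_space M" and n: "n \<ge> 1"
    and indep: "prob_space.indep_vars M (\<lambda>_. P) \<xi> {1..n}"
    and distr: "\<And>i. i \<in> {1..n} \<Longrightarrow> distr M P (\<xi> i) = P"
    and g: "g \<in> borel_measurable P" "\<And>x. x \<in> space P \<Longrightarrow> \<bar>g x\<bar> \<le> B"
    and le: "\<And>x. x \<in> space P \<Longrightarrow> g x - (\<integral>x. g x \<partial>P) \<le> b"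
    and "0 < b" "0 < t"
  shows "measure M {\<omega>\<in>space M. sqrt (2 * t / real n * prob_space.variance P g) + b * t / (3 * real n)
      \<le> emp_mean n \<xi> \<omega> g - (\<integral>x. g x \<partial>P)} \<le> exp (-t)"
proof -
  interpret prob_space M by fact
  have \<xi>: "\<xi> i \<in> measurable M P" if "i \<in> {1..n}" for i
    using indep that unfolding indep_vars_def by auto
  define X where "X i \<omega> = g (\<xi> i \<omega>)" for i \<omega>
  define \<mu> where "\<mu> = (\<integral>x. g x \<partial>P)"
  define v where "v = prob_space.variance P g"
  have X_meas: "X i \<in> borel_measurable M" if "i \<in> {1..n}" for i
    unfolding X_def using measurable_compose[OF \<xi>[OF that] g(1)] .
  have int: "expectation (\<lambda>\<omega>. h (\<xi> i \<omega>)) = (\<integral>x. h x \<partial>P)"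
    if "i \<in> {1..n}" "h \<in> borel_measurable P" for i and h :: "'x \<Rightarrow> real"
    using integral_distr[OF \<xi>[OF that(1)] that(2)] distr[OF that(1)] by simp
  have EX: "expectation (X i) = \<mu>" if "i \<in> {1..n}" for i
    unfolding X_def \<mu>_def using int[OF that g(1)] .
  have VX: "variance (X i) = v" if "i \<in> {1..n}" for i
    unfolding EX[OF that] unfolding X_def v_def \<mu>_def
    by (rule int[OF that, of "\<lambda>x. (g x - integral\<^sup>L P g)\<^sup>2"]) (use g(1) in measurable)
  have space: "\<xi> i \<omega> \<in> space P" if "i \<in> {1..n}" "\<omega> \<in> space M" for i \<omega>
    using measurable_space[OF \<xi>[OF that(1)] that(2)] .
  have "prob {\<omega>\<in>space M. sqrt (2 * (\<Sum>i\<in>{1..n}. variance (X i)) * t) + b * t / 3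
          \<le> (\<Sum>i\<in>{1..n}. X i \<omega>) - (\<Sum>i\<in>{1..n}. expectation (X i))} \<le> exp (-t)"
  proof (rule Bernstein_ineq_ge)
    show "indep_vars (\<lambda>_. borel) X {1..n}"
      unfolding X_def by (rule indep_vars_compose2[OF indep]) (rule g(1))
    fix i assume i: "i \<in> {1..n}"
    show "integrable M (\<lambda>x. (X i x)\<^sup>2)"
    proof (rule integrable_const_bound[where B = "B\<^sup>2"])
      show "(\<lambda>x. (X i x)\<^sup>2) \<in> borel_measurable M"
        using X_meas[OF i] by measurable
      show "AE x in M. norm ((X i x)\<^sup>2) \<le> B\<^sup>2"
        using power_mono[OF g(2)[OF space[OF i]], of _ 2] by (auto simp: X_def)
    qed
    show "AE x in M. X i x - expectation (X i) \<le> b"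
      unfolding EX[OF i] using le[OF space[OF i]] by (auto simp: X_def \<mu>_def)
  qed (use assms in auto)
  also have "(\<Sum>i\<in>{1..n}. variance (X i)) = real n * v"
    using VX by simp
  also have "(\<Sum>i\<in>{1..n}. expectation (X i)) = real n * \<mu>"
    using EX by simp
  also have "{\<omega>\<in>space M. sqrt (2 * (real n * v) * t) + b * t / 3 \<le> (\<Sum>i\<in>{1..n}. X i \<omega>) - real n * \<mu>}
    = {\<omega>\<in>space M. sqrt (2 * t / real n * v) + b * t / (3 * real n) \<le> emp_mean n \<xi> \<omega> g - \<mu>}"
  proof -
    have "2 * (real n * v) * t = (real n)\<^sup>2 * (2 * t / real n * v)"
      using n by (simp add: power2_eq_square field_simps)
    then have "sqrt (2 * (real n * v) * t) = real n * sqrt (2 * t / real n * v)"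
      by (simp only: real_sqrt_mult[of "(real n)\<^sup>2"] real_sqrt_abs abs_of_nat)
    then have 1: "sqrt (2 * (real n * v) * t) + b * t / 3
        = real n * (sqrt (2 * t / real n * v) + b * t / (3 * real n))"
      using n by (simp add: field_simps)
    have 2: "(\<Sum>i\<in>{1..n}. X i \<omega>) - real n * \<mu> = real n * (emp_mean n \<xi> \<omega> g - \<mu>)" for \<omega>
      using n by (simp add: emp_mean_def X_def field_simps)
    show ?thesis
      unfolding 1 2 using n by (subst mult_le_cancel_left_pos) auto
  qed
  finally show ?thesis
    by (simp only: \<mu>_def v_def)
qed

section \<open>Events of prescribed probability\<close>

text \<open>Finite subadditivity bounds the partial unions along an enumeration by the extended real
  sum, and continuity from below passes to the full union. A divergent sum merely makes the claimed
  probability bound trivial.\<close>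

lemma holds_with_prob_ge_union_bound:
  fixes e :: "'m \<Rightarrow> real"
  assumes "prob_space M" and Q: "holds_with_prob_ge M p Q" and I: "countable I"
    and B: "\<And>m. m \<in> I \<Longrightarrow> B m \<in> sets M" "\<And>m. m \<in> I \<Longrightarrow> measure M (B m) \<le> e m"
  shows "holds_with_prob_ge M (p - (\<Sum>\<^sub>\<infinity>m\<in>I. ereal (e m)))
           (\<lambda>\<omega>. \<omega> \<in> space M \<and> Q \<omega> \<and> (\<forall>m\<in>I. \<omega> \<notin> B m))"
proof (cases "I = {}")
  case True
  obtain E where "E \<in> sets M" "p \<le> ereal (measure M E)" "\<And>\<omega>. \<omega> \<in> E \<Longrightarrow> Q \<omega>"
    using Q unfolding holds_with_prob_ge_def by auto
  then show ?thesis
    unfolding holds_with_prob_ge_def using True sets.sets_into_space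
    by (auto intro!: bexI[of _ E])
next
  case False
  interpret prob_space M by fact
  obtain E where E: "E \<in> sets M" "p \<le> ereal (measure M E)" "\<And>\<omega>. \<omega> \<in> E \<Longrightarrow> Q \<omega>"
    using Q unfolding holds_with_prob_ge_def by auto
  define U where "U = (\<Union>m\<in>I. B m)"
  have U: "U \<in> sets M"
    unfolding U_def using I B(1) by (intro sets.countable_UN') auto
  define S where "S = (\<Sum>\<^sub>\<infinity>m\<in>I. ereal (e m))"
  have e_nonneg: "0 \<le> e m" if "m \<in> I" for m
    using B(2)[OF that] measure_nonneg order_trans by blast
  have S: "S = (SUP J\<in>{J. finite J \<and> J \<subseteq> I}. \<Sum>m\<in>J. ereal (e m))"
    unfolding S_def by (rule nonneg_infsum_complete) (use e_nonneg in auto)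
  \<comment> \<open>\<open>I\<close> is nonempty here, so it has an enumeration, with repetitions if
    \<open>I\<close> is finite. Summing over images of \<open>enum\<close> counts each index
    once.\<close>
  define enum where "enum = from_nat_into I"
  have enum: "range enum = I"
    unfolding enum_def using False I by (rule range_from_nat_into)
  define A where "A k = (\<Union>m\<in>enum ` {..k}. B m)" for k :: nat
  have fin: "ereal (measure M (A k)) \<le> S" for k
  proof -
    have "measure M (A k) \<le> (\<Sum>m\<in>enum ` {..k}. measure M (B m))"
      unfolding A_def using enum B(1) by (intro finite_measure_subadditive_finite) auto
    also have "\<dots> \<le> (\<Sum>m\<in>enum ` {..k}. e m)"
      using enum B(2) by (intro sum_mono) auto
    finally have "ereal (measure M (A k)) \<le> (\<Sum>m\<in>enum ` {..k}. ereal (e m))"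
      by simp
    also have "\<dots> \<le> S"
      unfolding S using enum by (intro SUP_upper) auto
    finally show ?thesis .
  qed
  have "(\<lambda>k. measure M (A k)) \<longlonglongrightarrow> measure M (\<Union>k. A k)"
  proof (rule finite_Lim_measure_incseq)
    show "range A \<subseteq> sets M"
      unfolding A_def using enum B(1) by (auto intro!: sets.finite_UN)
    show "incseq A"
      unfolding A_def by (intro incseq_SucI) (auto simp: atMost_Suc)
  qed
  moreover have "(\<Union>k. A k) = U"
    unfolding A_def U_def enum[symmetric] by auto
  ultimately have "(\<lambda>k. ereal (measure M (A k))) \<longlonglongrightarrow> ereal (measure M U)"
    by (simp add: lim_ereal)
  then have US: "ereal (measure M U) \<le> S"
    by (rule LIMSEQ_le_const2) (use fin in auto)
  have "measure M E \<le> measure M ((E - U) \<union> U)"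
    using E U by (intro finite_measure_mono) auto
  also have "\<dots> \<le> measure M (E - U) + measure M U"
    using E U by (intro measure_Un_le) auto
  finally have "ereal (measure M E) - ereal (measure M U) \<le> ereal (measure M (E - U))"
    by simp
  moreover have "p - S \<le> ereal (measure M E) - ereal (measure M U)"
    using E(2) US by (rule ereal_minus_mono)
  ultimately have "p - S \<le> ereal (measure M (E - U))"
    by (rule order_trans[rotated])
  moreover have "E - U \<in> sets M" using E U by auto
  moreover have "\<omega> \<in> space M \<and> Q \<omega> \<and> (\<forall>m\<in>I. \<omega> \<notin> B m)" if "\<omega> \<in> E - U" for \<omega>
    using that E sets.sets_into_space[OF E(1)] by (auto simp: U_def)
  ultimately show ?thesis
    unfolding holds_with_prob_ge_def S_def by blast
qed

lemma holds_with_prob_ge_mono: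
  assumes "holds_with_prob_ge M p Q" "\<And>\<omega>. Q \<omega> \<Longrightarrow> Q' \<omega>"
  shows "holds_with_prob_ge M p Q'"
  using assms unfolding holds_with_prob_ge_def by blast

section \<open>Young's inequality for the conjugate\<close>

text \<open>The conjugate may be infinite, but its minimum with \<open>s\<close> is a real number,
  so later estimates can stay in the reals. If the conjugate is the smaller one, Young's inequality
  at s / \<epsilon> is multiplied by \<epsilon> <= 1; otherwise y <= 1 gives s y <= s.\<close>

lemma min_convex_conjugate_real:
  fixes \<phi> :: "real \<Rightarrow> real" and s \<epsilon> :: real
  assumes "\<phi> 0 = 0" "0 \<le> s" "0 < \<epsilon>" "\<epsilon> \<le> 1"
    and \<phi>_nonneg: "\<And>y. 0 \<le> y \<Longrightarrow> 0 \<le> \<phi> y"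
  obtains k where "min (convex_conjugate \<phi> (s / \<epsilon>)) (ereal s) = ereal k" "0 \<le> k"
    "\<And>y. 0 \<le> y \<Longrightarrow> y \<le> 1 \<Longrightarrow> s * y \<le> \<epsilon> * \<phi> y + k"
proof -
  define c where "c = convex_conjugate \<phi> (s / \<epsilon>)"
  have c: "ereal (s / \<epsilon> * y - \<phi> y) \<le> c" if "0 \<le> y" for y
    unfolding c_def convex_conjugate_def using that by (intro SUP_upper) auto
  have "0 \<le> c" using c[of 0] assms by (simp add: zero_ereal_def)
  show ?thesis
  proof (cases "c \<le> ereal s")
    case True
    then obtain k where k: "c = ereal k"
      using \<open>0 \<le> c\<close> by (cases c) auto
    show ?thesis
    proof (rule that[of k])
      show "min (convex_conjugate \<phi> (s / \<epsilon>)) (ereal s) = ereal k"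
        using True k unfolding c_def by (simp add: min_def)
      show "0 \<le> k" using \<open>0 \<le> c\<close> k by simp
      fix y :: real assume y: "0 \<le> y" "y \<le> 1"
      have "s / \<epsilon> * y - \<phi> y \<le> k" using c[OF y(1)] k by simp
      then have "\<epsilon> * (s / \<epsilon> * y - \<phi> y) \<le> \<epsilon> * k" using assms by (intro mult_left_mono) auto
      moreover have "\<epsilon> * (s / \<epsilon> * y - \<phi> y) = s * y - \<epsilon> * \<phi> y"
        using assms by (simp add: algebra_simps)
      moreover have "\<epsilon> * k \<le> k"
        using \<open>0 \<le> k\<close> assms by (simp add: mult_left_le_one_le)
      ultimately show "s * y \<le> \<epsilon> * \<phi> y + k" by linarith
    qed
  next
    case False
    show ?thesis
    proof (rule that[of s])
      show "min (convex_conjugate \<phi> (s / \<epsilon>)) (ereal s) = ereal s"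
        using False unfolding c_def by (simp add: min_def)
      fix y :: real assume y: "0 \<le> y" "y \<le> 1"
      then show "s * y \<le> \<epsilon> * \<phi> y + s"
        using assms \<phi>_nonneg[OF y(1)] mult_left_le[of y s] by (smt (verit) mult_nonneg_nonneg)
    qed (use assms in auto)
  qed
qed

lemma emp_mean_diff:
  "emp_mean n \<xi> \<omega> (\<lambda>x. g x - h x) = emp_mean n \<xi> \<omega> g - emp_mean n \<xi> \<omega> h"
  by (simp add: emp_mean_def sum_subtractf diff_divide_distrib)

lemma emp_mean_minus:
  "emp_mean n \<xi> \<omega> (\<lambda>x. - g x) = - emp_mean n \<xi> \<omega> g"
  by (simp add: emp_mean_def sum_negf)

section \<open>The oracle inequality for nested models\<close>

theorem theorem1:
  fixes M :: "'w measure" and P :: "'x measure"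
    and \<xi> :: "nat \<Rightarrow> 'w \<Rightarrow> 'x" and n :: nat
    and \<F> :: "('x \<Rightarrow> real) set" and fstar :: "'x \<Rightarrow> real"
    and I :: "'m set" and Fm :: "'m \<Rightarrow> ('x \<Rightarrow> real) set"
    and f :: "'m \<Rightarrow> 'x \<Rightarrow> real"
    and fhat :: "'w \<Rightarrow> 'm \<Rightarrow> 'x \<Rightarrow> real"
    and pen :: "'w \<Rightarrow> 'm \<Rightarrow> real" and mhat :: "'w \<Rightarrow> 'm"
    and \<phi> :: "'m \<Rightarrow> real \<Rightarrow> real" and t v :: "'m \<Rightarrow> real"
    and c \<eta> C\<^sub>1 C\<^sub>2 :: real
  assumes "prob_space M" and "prob_space P" and "n \<ge> 1"
    and iid: "prob_space.indep_vars M (\<lambda>_. P) \<xi> {1..n}"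
             "\<And>i. i \<in> {1..n} \<Longrightarrow> distr M P (\<xi> i) = P"
    and F: "\<F> \<subseteq> borel_measurable P \<inter> (space P \<rightarrow> {0..1})"
    and fstar: "is_arg_min (\<lambda>g. \<integral>x. g x \<partial>P) (\<lambda>g. g \<in> \<F>) fstar"
    and I: "countable I"
    and models: "\<And>m. m \<in> I \<Longrightarrow> Fm m \<subseteq> \<F>"
    and f: "\<And>m. m \<in> I \<Longrightarrow> is_arg_min (\<lambda>g. \<integral>x. g x \<partial>P) (\<lambda>g. g \<in> Fm m) (f m)"
    and fhat: "\<And>\<omega> m. \<omega> \<in> space M \<Longrightarrow> m \<in> I \<Longrightarrow>
                 is_arg_min (emp_mean n \<xi> \<omega>) (\<lambda>g. g \<in> Fm m) (fhat \<omega> m)"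
    and \<phi>: "\<And>m. m \<in> I \<Longrightarrow> convex_on {0..} (\<phi> m)"
           "\<And>m. m \<in> I \<Longrightarrow> mono_on {0..} (\<phi> m)"
           "\<And>m. m \<in> I \<Longrightarrow> \<phi> m 0 = 0"
    and margin: "\<And>m g. m \<in> I \<Longrightarrow> g \<in> Fm m \<Longrightarrow>
                   excess_risk P fstar g \<ge> \<phi> m (sqrt (excess_var P fstar g))"
    and t: "\<And>m. m \<in> I \<Longrightarrow> t m > 0"
           "\<And>m m'. m \<in> I \<Longrightarrow> m' \<in> I \<Longrightarrow> Fm m' \<subseteq> Fm m \<Longrightarrow> t m' \<le> t m"
    and v: "\<And>m. m \<in> I \<Longrightarrow> v m = sqrt (2 * t m / real n * excess_var P fstar (f m))"
    and constants: "c \<in> {0<..<1}" "\<eta> \<in> {0<..<1}" "C\<^sub>1 \<ge> 0" "C\<^sub>2 \<ge> 0"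
    and nested: "\<And>m m'. m \<in> I \<Longrightarrow> m' \<in> I \<Longrightarrow> Fm m \<subseteq> Fm m' \<or> Fm m' \<subseteq> Fm m"
    and penalty: "holds_with_prob_ge M (ereal (1 - \<eta>)) (\<lambda>\<omega>. \<forall>m\<in>I. \<forall>m'\<in>I.
        (let d = (\<lambda>x. fhat \<omega> m x - f m x);
             \<Delta> = (\<integral>x. d x \<partial>P) - emp_mean n \<xi> \<omega> d + t m / real n
         in (1 - c) * pen \<omega> m \<ge> \<Delta> \<and> \<Delta> \<ge> 0) \<and>
        (Fm m' \<subseteq> Fm m \<longrightarrow>
           c * pen \<omega> m \<ge> v m - C\<^sub>1 * v m' - C\<^sub>2 * excess_risk P fstar (f m')))"
    and mhat: "\<And>\<omega>. \<omega> \<in> space M \<Longrightarrow>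
        is_arg_min (\<lambda>m. emp_mean n \<xi> \<omega> (fhat \<omega> m) + pen \<omega> m) (\<lambda>m. m \<in> I) (mhat \<omega>)"
  shows "holds_with_prob_ge M
      (ereal (1 - \<eta>) - 2 * (\<Sum>\<^sub>\<infinity>m\<in>I. ereal (exp (- t m))))
      (\<lambda>\<omega>. \<forall>\<epsilon>\<in>{0<..<1}.
        ereal (excess_risk P fstar (fhat \<omega> (mhat \<omega>))) \<le>
          ereal (1 / (1 - \<epsilon>)) * (INF m\<in>I.
             ereal ((1 + \<epsilon> + C\<^sub>2 + \<epsilon> * C\<^sub>1) * excess_risk P fstar (f m)) + ereal (pen \<omega> m)
             + ereal (1 + max 1 C\<^sub>1) *
                 min (convex_conjugate (\<phi> m) (sqrt (2 * t m / (\<epsilon>\<^sup>2 * real n))))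
                     (ereal (sqrt (2 * t m / real n)))
             + ereal (t m / (3 * real n))))"
proof -
  interpret M: prob_space M by fact
  interpret P: prob_space P by fact
  note n = \<open>n \<ge> 1\<close>
  define R where "R = excess_risk P fstar"
  define s where "s m = sqrt (2 * t m / real n)" for m
  define sd where "sd g = sqrt (excess_var P fstar g)" for g

  \<comment> \<open>Excess risks and variances of [0,1]-valued functions\<close>
  have fstar_mem: "fstar \<in> \<F>"
    using fstar by (simp add: is_arg_min_def)
  have meas: "g \<in> borel_measurable P" if "g \<in> \<F>" for g
    using F that by auto
  have range01: "0 \<le> g x" "g x \<le> 1" if "g \<in> \<F>" "x \<in> space P" for g x
    using F that by (auto dest!: subsetD simp: Pi_iff)
  have int: "integrable P g" if "g \<in> \<F>" for g
    by (rule P.integrable_const_bound[where B = 1])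
       (use meas[OF that] range01[OF that] in auto)
  have R: "R g = (\<integral>x. g x \<partial>P) - (\<integral>x. fstar x \<partial>P)" if "g \<in> \<F>" for g
    unfolding R_def excess_risk_def using int that fstar_mem by simp
  have R_nonneg: "0 \<le> R g" if "g \<in> \<F>" for g
    using fstar that R[OF that] by (auto simp: is_arg_min_linorder)
  have diff_bound: "\<bar>g x - fstar x\<bar> \<le> 1" if "g \<in> \<F>" "x \<in> space P" for g x
    using range01[OF that] range01[OF fstar_mem that(2)] by linarith
  have diff_meas: "(\<lambda>x. g x - fstar x) \<in> borel_measurable P" if "g \<in> \<F>" for g
    using meas[OF that] meas[OF fstar_mem] by measurable
  have diff_int: "integrable P (\<lambda>x. g x - fstar x)" if "g \<in> \<F>" for g
    using int that fstar_mem by auto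
  have R_le_1: "R g \<le> 1" if "g \<in> \<F>" for g
  proof -
    have "R g \<le> (\<integral>x. 1 \<partial>P)"
      unfolding R_def excess_risk_def using diff_int[OF that] diff_bound[OF that]
      by (intro integral_mono) (auto simp: abs_le_iff)
    then show ?thesis by (simp add: P.prob_space)
  qed
  \<comment> \<open>Standard deviations are thus at most 1, the range of y required by
    \<open>min_convex_conjugate_real\<close>; this is the source of the alternative sqrt (2 t / n)
    in the minimum.\<close>
  have var_le_1: "excess_var P fstar g \<le> 1" if "g \<in> \<F>" for g
  proof -
    have sq: "integrable P (\<lambda>x. (g x - fstar x)\<^sup>2)"
      by (rule P.integrable_const_bound[where B = 1])
         (use diff_meas[OF that] diff_bound[OF that] in \<open>auto simp: abs_square_le_1\<close>)
    have "excess_var P fstar g = (\<integral>x. (g x - fstar x)\<^sup>2 \<partial>P) - (R g)\<^sup>2"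
      unfolding excess_var_def R_def excess_risk_def
      using diff_int[OF that] sq by (rule P.variance_eq)
    also have "\<dots> \<le> (\<integral>x. (g x - fstar x)\<^sup>2 \<partial>P)" by simp
    also have "\<dots> \<le> (\<integral>x. 1 \<partial>P)"
      using sq diff_bound[OF that] by (intro integral_mono) (auto simp: abs_square_le_1)
    finally show ?thesis by (simp add: P.prob_space)
  qed
  have sd: "0 \<le> sd g" "g \<in> \<F> \<Longrightarrow> sd g \<le> 1" for g
    using var_le_1[of g] by (auto simp: sd_def excess_var_def)

  have f_mem: "f m \<in> Fm m" "f m \<in> \<F>" if "m \<in> I" for m
    using f[OF that] models[OF that] by (auto simp: is_arg_min_def)
  have fhat_mem: "fhat \<omega> m \<in> \<F>" if "\<omega> \<in> space M" "m \<in> I" for \<omega> m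
    using fhat[OF that] models[OF that(2)] by (auto simp: is_arg_min_def)
  have s_pos: "0 < s m" if "m \<in> I" for m
    using t(1)[OF that] n by (simp add: s_def)
  have v_eq: "v m = s m * sd (f m)" if "m \<in> I" for m
    using v[OF that] by (simp only: s_def sd_def real_sqrt_mult)
  have \<phi>_nonneg: "0 \<le> \<phi> m y" if "m \<in> I" "0 \<le> y" for m y
    using mono_onD[OF \<phi>(2)[OF that(1)], of 0 y] \<phi>(3)[OF that(1)] that(2) by simp

  \<comment> \<open>Deviation events for the best functions of the models\<close>
  define d where "d m x = f m x - fstar x" for m x
  have \<xi>: "\<xi> i \<in> measurable M P" if "i \<in> {1..n}" for i
    using iid(1) that unfolding M.indep_vars_def by auto
  \<comment> \<open>\<open>Lo\<close> is to be avoided at the comparison index and \<open>Up\<close>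
    at the selected one. The first is arbitrary and the second random, so both families are excluded
    at all indices; hence the factor 2 before the sum.\<close>
  define Lo where "Lo m = {\<omega>\<in>space M. v m + t m / (3 * real n) \<le> emp_mean n \<xi> \<omega> (d m) - R (f m)}" for m
  define Up where "Up m = {\<omega>\<in>space M. v m + 2 * t m / (3 * real n) \<le> R (f m) - emp_mean n \<xi> \<omega> (d m)}" for m
  have d_meas: "d m \<in> borel_measurable P" if "m \<in> I" for m
    unfolding d_def using diff_meas[OF f_mem(2)[OF that]] .
  have d_int: "(\<integral>x. d m x \<partial>P) = R (f m)" for m
    by (simp add: d_def R_def excess_risk_def)
  have d_var: "excess_var P fstar (f m) = P.variance (d m)" for m
    by (simp add: excess_var_def d_def[abs_def])
  have d_bound: "\<bar>d m x\<bar> \<le> 1" if "m \<in> I" "x \<in> space P" for m x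
    unfolding d_def using diff_bound[OF f_mem(2)[OF that(1)] that(2)] .
  have emp_meas: "(\<lambda>\<omega>. emp_mean n \<xi> \<omega> (d m)) \<in> borel_measurable M" if "m \<in> I" for m
    using \<xi> d_meas[OF that] by (rule emp_mean_measurable)
  have sets: "Lo m \<in> sets M" "Up m \<in> sets M" if "m \<in> I" for m
    unfolding Lo_def Up_def using emp_meas[OF that] by measurable
  \<comment> \<open>Optimality of \<open>fstar\<close> makes the mean of \<open>d m\<close>
    nonnegative, so centring keeps the upper bound 1. This gives t / (3 n) in the final
    bound.\<close>
  have Lo: "measure M (Lo m) \<le> exp (- t m)" if m: "m \<in> I" for m
  proof -
    have "measure M {\<omega>\<in>space M. sqrt (2 * t m / real n * P.variance (d m)) + 1 * t m / (3 * real n)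
        \<le> emp_mean n \<xi> \<omega> (d m) - (\<integral>x. d m x \<partial>P)} \<le> exp (- t m)"
    proof (rule emp_mean_Bernstein[OF \<open>prob_space M\<close> n iid d_meas[OF m] d_bound[OF m]])
      show "d m x - (\<integral>x. d m x \<partial>P) \<le> 1" if "x \<in> space P" for x
        using d_bound[OF m that] R_nonneg[OF f_mem(2)[OF m]] unfolding d_int by linarith
    qed (use t(1)[OF m] in auto)
    then show ?thesis
      by (simp add: Lo_def d_int v[OF m] d_var)
  qed
  txt \<open>Here \<open>fstar - f m\<close> exceeds its mean by up to 2, which doubles the linear term of
    Bernstein's inequality; the term \<open>- t k / n\<close> from the penalty condition still absorbs it.\<close>
  have Up: "measure M (Up m) \<le> exp (- t m)" if m: "m \<in> I" for m
  proof -
    have "measure M {\<omega>\<in>space M. sqrt (2 * t m / real n * P.variance (\<lambda>x. - d m x)) + 2 * t m / (3 * real n)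
        \<le> emp_mean n \<xi> \<omega> (\<lambda>x. - d m x) - (\<integral>x. - d m x \<partial>P)} \<le> exp (- t m)"
    proof (rule emp_mean_Bernstein[OF \<open>prob_space M\<close> n iid, where B = 1])
      show "(\<lambda>x. - d m x) \<in> borel_measurable P" using d_meas[OF m] by measurable
      show "\<bar>- d m x\<bar> \<le> 1" if "x \<in> space P" for x using d_bound[OF m that] by simp
      show "- d m x - (\<integral>x. - d m x \<partial>P) \<le> 2" if "x \<in> space P" for x
        using d_bound[OF m that] R_le_1[OF f_mem(2)[OF m]] by (simp add: d_int)
    qed (use t(1)[OF m] in auto)
    moreover have "P.variance (\<lambda>x. - d m x) = P.variance (d m)"
      by (simp add: power2_commute)
    ultimately show ?thesis
      by (simp add: Up_def d_int v[OF m] d_var emp_mean_minus)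
  qed

  \<comment> \<open>The event of large probability\<close>
  define S where "S = (\<Sum>\<^sub>\<infinity>m\<in>I. ereal (exp (- t m)))"
  have S: "ereal (1 - \<eta>) - S - S = ereal (1 - \<eta>) - 2 * S"
    by (cases S) auto
  let ?pen_event = "\<lambda>\<omega>. \<forall>m\<in>I. \<forall>m'\<in>I.
        (let d = (\<lambda>x. fhat \<omega> m x - f m x);
             \<Delta> = (\<integral>x. d x \<partial>P) - emp_mean n \<xi> \<omega> d + t m / real n
         in (1 - c) * pen \<omega> m \<ge> \<Delta> \<and> \<Delta> \<ge> 0) \<and>
        (Fm m' \<subseteq> Fm m \<longrightarrow>
           c * pen \<omega> m \<ge> v m - C\<^sub>1 * v m' - C\<^sub>2 * excess_risk P fstar (f m'))"
  have event_Lo: "holds_with_prob_ge M (ereal (1 - \<eta>) - S)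
      (\<lambda>\<omega>. \<omega> \<in> space M \<and> ?pen_event \<omega> \<and> (\<forall>m\<in>I. \<omega> \<notin> Lo m))"
    unfolding S_def using \<open>prob_space M\<close> penalty I sets(1) Lo
    by (rule holds_with_prob_ge_union_bound)
  have event: "holds_with_prob_ge M (ereal (1 - \<eta>) - 2 * S)
      (\<lambda>\<omega>. \<omega> \<in> space M \<and> (\<omega> \<in> space M \<and> ?pen_event \<omega> \<and> (\<forall>m\<in>I. \<omega> \<notin> Lo m)) \<and> (\<forall>m\<in>I. \<omega> \<notin> Up m))"
    unfolding S[symmetric] unfolding S_def
    using \<open>prob_space M\<close> event_Lo[unfolded S_def] I sets(2) Up
    by (rule holds_with_prob_ge_union_bound)

  \<comment> \<open>Deterministic argument at a fixed outcome\<close>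
  have "holds_with_prob_ge M (ereal (1 - \<eta>) - 2 * S)
      (\<lambda>\<omega>. \<forall>\<epsilon>\<in>{0<..<1}.
        ereal (R (fhat \<omega> (mhat \<omega>))) \<le>
          ereal (1 / (1 - \<epsilon>)) * (INF m\<in>I.
             ereal ((1 + \<epsilon> + C\<^sub>2 + \<epsilon> * C\<^sub>1) * R (f m)) + ereal (pen \<omega> m)
             + ereal (1 + max 1 C\<^sub>1) *
                 min (convex_conjugate (\<phi> m) (sqrt (2 * t m / (\<epsilon>\<^sup>2 * real n))))
                     (ereal (sqrt (2 * t m / real n)))
             + ereal (t m / (3 * real n))))"
  \<comment> \<open>The event was built without reference to \<epsilon>, so one event serves all
    \<epsilon> at once.\<close>
  proof (rule holds_with_prob_ge_mono[OF event], elim conjE, intro ballI)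
    fix \<omega> and \<epsilon> :: real
    assume \<omega>: "\<omega> \<in> space M" and \<epsilon>: "\<epsilon> \<in> {0<..<1}"
      and pen: "?pen_event \<omega>"
      and notLo: "\<forall>m\<in>I. \<omega> \<notin> Lo m" and notUp: "\<forall>m\<in>I. \<omega> \<notin> Up m"
    define k where "k = mhat \<omega>"
    define X where "X = R (fhat \<omega> k)"
    have k: "k \<in> I"
      using mhat[OF \<omega>] by (simp add: is_arg_min_def k_def)
    have X: "0 \<le> X"
      unfolding X_def using R_nonneg fhat_mem[OF \<omega> k] .
    have \<Delta>: "(1 - c) * pen \<omega> k
          \<ge> (\<integral>x. fhat \<omega> k x - f k x \<partial>P) - emp_mean n \<xi> \<omega> (\<lambda>x. fhat \<omega> k x - f k x) + t k / real n"
        "(1 - c) * pen \<omega> k \<ge> 0"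
      using pen[rule_format, OF k k] by (auto simp: Let_def)
    have pen_nonneg: "0 \<le> c * pen \<omega> k"
      using \<Delta>(2) constants(1) by (simp add: zero_le_mult_iff)
    have int_fhat: "(\<integral>x. fhat \<omega> k x - f k x \<partial>P) = X - R (f k)"
      using int fhat_mem[OF \<omega> k] f_mem(2)[OF k] R by (simp add: X_def)
    \<comment> \<open>The real number \<open>q\<close> stands for the minimum in the statement;
      extended reals return only when the infimum is taken.\<close>
    have main: "(1 - \<epsilon>) * X \<le> (1 + \<epsilon> + C\<^sub>2 + \<epsilon> * C\<^sub>1) * R (f m) + pen \<omega> m + (1 + max 1 C\<^sub>1) * q
        + t m / (3 * real n)"
      if m: "m \<in> I" and q: "0 \<le> q"
        and conj: "\<And>y. 0 \<le> y \<Longrightarrow> y \<le> 1 \<Longrightarrow> s m * y \<le> \<epsilon> * \<phi> m y + q" for m q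
    proof -
      have s_le: "s m * sd g \<le> \<epsilon> * R g + q" if "g \<in> Fm m" for g
      proof -
        have "g \<in> \<F>" using models[OF m] that by auto
        then have "s m * sd g \<le> \<epsilon> * \<phi> m (sd g) + q" by (intro conj sd)
        also have "\<epsilon> * \<phi> m (sd g) \<le> \<epsilon> * R g"
          using margin[OF m that] \<epsilon> by (intro mult_left_mono) (auto simp: R_def sd_def)
        finally show ?thesis by simp
      qed
      have v_le: "v m \<le> \<epsilon> * R (f m) + q"
        using s_le[OF f_mem(1)[OF m]] v_eq[OF m] by simp
      have R0: "0 \<le> R (f m)" using R_nonneg f_mem(2)[OF m] .
      have "emp_mean n \<xi> \<omega> (fhat \<omega> k) + pen \<omega> k \<le> emp_mean n \<xi> \<omega> (fhat \<omega> m) + pen \<omega> m"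
        using mhat[OF \<omega>] m by (auto simp: is_arg_min_linorder k_def)
      moreover have "emp_mean n \<xi> \<omega> (fhat \<omega> m) \<le> emp_mean n \<xi> \<omega> (f m)"
        using fhat[OF \<omega> m] f_mem(1)[OF m] by (auto simp: is_arg_min_linorder)
      moreover have "emp_mean n \<xi> \<omega> (d m) - R (f m) \<le> v m + t m / (3 * real n)"
        using notLo m \<omega> by (auto simp: Lo_def)
      moreover have "R (f k) - emp_mean n \<xi> \<omega> (d k) \<le> v k + 2 * t k / (3 * real n)"
        using notUp k \<omega> by (auto simp: Up_def)
      moreover have "2 * t k / (3 * real n) \<le> t k / real n"
        using t(1)[OF k] n by (simp add: field_simps)
      ultimately have basic: "X \<le> R (f m) + pen \<omega> m - c * pen \<omega> k + v k + v m + t m / (3 * real n)"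
        using \<Delta>(1) unfolding int_fhat d_def[abs_def] emp_mean_diff by (simp add: left_diff_distrib)
      show ?thesis
      proof (cases "Fm m \<subseteq> Fm k")
        case True
        then have "v k - C\<^sub>1 * v m - C\<^sub>2 * R (f m) \<le> c * pen \<omega> k"
          using pen[rule_format, OF k m] by (simp add: R_def)
        then have "X \<le> (1 + C\<^sub>2) * R (f m) + pen \<omega> m + (1 + C\<^sub>1) * v m + t m / (3 * real n)"
          using basic by (simp add: algebra_simps)
        \<comment> \<open>Besides the \<open>v m\<close> of the Bernstein bound, the penalty
          condition contributes \<open>C\<^sub>1 * v m\<close>; together they produce the summand
          \<epsilon> + \<epsilon> \<open>C\<^sub>1\<close> in the coefficient of the risk.\<close>
        moreover have "(1 + C\<^sub>1) * v m \<le> (1 + C\<^sub>1) * (\<epsilon> * R (f m) + q)"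
          using v_le constants by (intro mult_left_mono) auto
        moreover have "(1 + C\<^sub>1) * q \<le> (1 + max 1 C\<^sub>1) * q"
          using q by (intro mult_right_mono) auto
        moreover have "(1 - \<epsilon>) * X \<le> X"
          using X \<epsilon> by (simp add: mult_left_le_one_le)
        ultimately show ?thesis by (simp add: algebra_simps)
      next
        case False
        then have sub: "Fm k \<subseteq> Fm m" using nested[OF m k] by blast
        \<comment> \<open>Monotonicity of \<open>t\<close> replaces \<open>s k\<close> by
          \<open>s m\<close>, so that the conjugate belongs to the comparison index rather than to
          the random one.\<close>
        have "s k \<le> s m"
          unfolding s_def using t(2)[OF m k sub] n
          by (intro real_sqrt_le_mono divide_right_mono) auto
        then have "v k \<le> s m * sd (f k)"
          unfolding v_eq[OF k] using sd by (intro mult_right_mono) auto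
        also have "\<dots> \<le> \<epsilon> * R (f k) + q"
          using f_mem(1)[OF k] sub by (intro s_le) auto
        also have "\<epsilon> * R (f k) \<le> \<epsilon> * X"
        proof -
          have "(\<integral>x. f k x \<partial>P) \<le> (\<integral>x. fhat \<omega> k x \<partial>P)"
            using f[OF k] fhat[OF \<omega> k] by (auto simp: is_arg_min_linorder)
          then show ?thesis
            unfolding X_def using \<epsilon> R[OF f_mem(2)[OF k]] R[OF fhat_mem[OF \<omega> k]]
            by (intro mult_left_mono) auto
        qed
        \<comment> \<open>Moving \<epsilon> X to the left side costs the factor 1 / (1 -
          \<epsilon>).\<close>
        finally have "v k \<le> \<epsilon> * X + q" by simp
        \<comment> \<open>Here \<open>v k\<close> and \<open>v m\<close> contribute one
          \<open>q\<close> each, whereas the other case needs \<open>1 + C\<^sub>1\<close> of them;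
          this explains the maximum in the constant.\<close>
        moreover have "2 * q \<le> (1 + max 1 C\<^sub>1) * q"
          using q by (intro mult_right_mono) auto
        moreover have "0 \<le> C\<^sub>2 * R (f m)" "0 \<le> \<epsilon> * C\<^sub>1 * R (f m)"
          using R0 constants \<epsilon> by auto
        ultimately show ?thesis
          using basic v_le pen_nonneg by (simp add: algebra_simps)
      qed
    qed
    have "ereal ((1 - \<epsilon>) * X) \<le> (INF m\<in>I.
             ereal ((1 + \<epsilon> + C\<^sub>2 + \<epsilon> * C\<^sub>1) * R (f m)) + ereal (pen \<omega> m)
             + ereal (1 + max 1 C\<^sub>1) *
                 min (convex_conjugate (\<phi> m) (sqrt (2 * t m / (\<epsilon>\<^sup>2 * real n))))
                     (ereal (sqrt (2 * t m / real n)))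
             + ereal (t m / (3 * real n)))" (is "_ \<le> ?inf")
    proof (rule INF_greatest)
      fix m assume m: "m \<in> I"
      have "sqrt (2 * t m / (\<epsilon>\<^sup>2 * real n)) = s m / \<epsilon>"
        using \<epsilon> by (simp add: s_def real_sqrt_divide real_sqrt_mult)
      moreover obtain q where "min (convex_conjugate (\<phi> m) (s m / \<epsilon>)) (ereal (s m)) = ereal q" "0 \<le> q"
          "\<And>y. 0 \<le> y \<Longrightarrow> y \<le> 1 \<Longrightarrow> s m * y \<le> \<epsilon> * \<phi> m y + q"
        using min_convex_conjugate_real[of "\<phi> m" "s m" \<epsilon>] \<phi>(3)[OF m] \<phi>_nonneg[OF m] s_pos[OF m] \<epsilon>
        by (auto intro: less_imp_le)
      ultimately show "ereal ((1 - \<epsilon>) * X) \<le> ereal ((1 + \<epsilon> + C\<^sub>2 + \<epsilon> * C\<^sub>1) * R (f m)) + ereal (pen \<omega> m)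
             + ereal (1 + max 1 C\<^sub>1) *
                 min (convex_conjugate (\<phi> m) (sqrt (2 * t m / (\<epsilon>\<^sup>2 * real n))))
                     (ereal (sqrt (2 * t m / real n)))
             + ereal (t m / (3 * real n))"
        using main[OF m, of q] by (simp add: s_def[symmetric])
    qed
    then have "ereal (1 / (1 - \<epsilon>)) * ereal ((1 - \<epsilon>) * X) \<le> ereal (1 / (1 - \<epsilon>)) * ?inf"
      using \<epsilon> by (intro ereal_mult_left_mono) auto
    moreover have "ereal (1 / (1 - \<epsilon>)) * ereal ((1 - \<epsilon>) * X) = ereal X"
      using \<epsilon> by simp
    ultimately show "ereal (R (fhat \<omega> (mhat \<omega>))) \<le> ereal (1 / (1 - \<epsilon>)) * ?inf"
      by (simp add: X_def k_def)
  qed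
  then show ?thesis
    by (simp only: S_def R_def)
qed

end
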